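(* Let $\Theta\subseteq\mathbb{R}$. Then $\Theta$ has (at most) countable closure if and only if the following holds: for all intervals $I\subseteq\mathbb{R}$ and all functions $f\colon I\to\mathbb{R}$, if $f$ is continuous and $f$ is intrinsically Lipschitz continuous with exception set $\Theta$ (that is, $f$ is intrinsically Lipschitz continuous on $I\setminus\Theta$), then $f$ is Lipschitz continuous on $I$.
   Context: Here $\mathbb{R}$ and its subintervals carry the Euclidean metric. A path in a metric space $(M,d)$ is a continuous map $\gamma\colon[a,b]\to M$, from $\gamma(a)$ to $\gamma(b)$; its length is $\ell(\gamma):=\sup\{\sum_{k=1}^n d(\gamma(t_k),\gamma(t_{k-1})) : n\in\mathbb{N},\ a=t_0<\dots<t_n=b\}$. For $E\subseteq M$ and $x,y\in E$, the intrinsic metric $\rho_E(x,y)$ is the infimum of $\ell(\gamma)$ over all paths $\gamma$ of finite length with image in $E$ from $x$ to $y$, with $\inf\emptyset=\infty$. A function $f\colon M\to\mathbb{R}$ is intrinsically Lipschitz continuous on $E\subseteq M$ if there is $L$ such that $|f(x)-f(y)|\le L\,\rho_E(x,y)$ for all $x,y\in E$ (no condition is imposed when $\rho_E(x,y)=\infty$); the complement $M\setminus E$ is then called an exception set of $f$. Here $M=I$. *)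

theory Defs
  imports "HOL-Analysis.Analysis"
begin

(* A path on {a..b} is a total function of type real => 'a of which only the values on {a..b} count.
   The case a = b is allowed; the only subdivision is then n = 0, and the length is 0. *)

definition is_subdivision :: "real \<Rightarrow> real \<Rightarrow> nat \<Rightarrow> (nat \<Rightarrow> real) \<Rightarrow> bool" where
  "is_subdivision a b n t \<longleftrightarrow> t 0 = a \<and> t n = b \<and> (\<forall>k<n. t k < t (Suc k))"

definition curve_length :: "real \<Rightarrow> real \<Rightarrow> (real \<Rightarrow> 'a::metric_space) \<Rightarrow> ereal" where
  "curve_length a b \<gamma> =
     Sup {ereal (\<Sum>k=1..n. dist (\<gamma> (t k)) (\<gamma> (t (k - 1)))) | n t. is_subdivision a b n t}"

(* The ambient metric space M does not occur as a parameter: paths with image in E \<subseteq> M, their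
   continuity and their length depend only on E. The infimum of the empty set in ereal is \<infinity>. *)

definition intrinsic_metric :: "'a::metric_space set \<Rightarrow> 'a \<Rightarrow> 'a \<Rightarrow> ereal" where
  "intrinsic_metric E x y =
     Inf {curve_length a b \<gamma> | a b \<gamma>.
       a \<le> b \<and> continuous_on {a..b} \<gamma> \<and> \<gamma> ` {a..b} \<subseteq> E \<and> \<gamma> a = x \<and> \<gamma> b = y \<and>
       curve_length a b \<gamma> < \<infinity>}"

(* The guard is needed because 0 * \<infinity> = 0 in ereal. *)

definition intrinsically_lipschitz_on :: "'a::metric_space set \<Rightarrow> ('a \<Rightarrow> real) \<Rightarrow> bool" where
  "intrinsically_lipschitz_on E f \<longleftrightarrow>
     (\<exists>L::real. \<forall>x\<in>E. \<forall>y\<in>E. intrinsic_metric E x y < \<infinity> \<longrightarrow>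
        ereal \<bar>f x - f y\<bar> \<le> ereal L * intrinsic_metric E x y)"

end

theory Submission
  imports Defs
begin

text \<open>
  If the closure \<open>C\<close> of \<open>\<Theta>\<close> is countable and \<open>g\<close> is \<open>f\<close> minus a linear function whose slope is the
  intrinsic Lipschitz constant, then \<open>g\<close> is nonincreasing near every point outside \<open>C\<close>. Were
  \<open>g x < g y\<close> for some \<open>x < y\<close>, one could choose a level \<open>c\<close> between these values outside the
  countable set \<open>g ` C\<close>; at the last point of \<open>[x, y]\<close> where \<open>g \<le> c\<close> this gives a contradiction.

  If \<open>C\<close> is uncountable, splitting \<open>C\<close> repeatedly into two uncountable parts yields a continuous
  monotone surjection \<open>F\<close> of some \<open>[a, b]\<close> onto \<open>[0, 1]\<close> which is constant on the intervals missing
  \<open>C\<close>, like the Cantor function. It may be Lipschitz (if \<open>C\<close> has positive measure), but its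
  composition with a continuous function of unbounded variation is not.
\<close>

section \<open>A Cantor-like function adapted to an uncountable set\<close>

text \<open>By second countability all but countably many points of \<open>C\<close> are
  condensation points: each of their neighbourhoods meets \<open>C\<close> in an uncountable set. A
  cut between two such points leaves uncountably many points on either side.\<close>

lemma uncountable_Int_interval_split:
  fixes C :: "real set"
  assumes "uncountable (C \<inter> {x..y})"
  obtains z where "x < z" "z < y" "uncountable (C \<inter> {x..z})" "uncountable (C \<inter> {z..y})"
proof -
  obtain \<B> :: "real set set" where \<B>: "countable \<B>" "topological_basis \<B>"
    using ex_countable_basis by blast
  define D where "D = (\<Union>B\<in>{B\<in>\<B>. countable (C \<inter> B)}. C \<inter> B)"
  have "countable D"
    unfolding D_def using \<B>(1) by (intro countable_UN) auto
  have condensation: "uncountable (C \<inter> U)" if p: "p \<in> C - D" "open U" "p \<in> U" for p U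
  proof
    assume "countable (C \<inter> U)"
    moreover obtain B where "B \<in> \<B>" "p \<in> B" "B \<subseteq> U"
      using topological_basisE[OF \<B>(2) p(2,3)] by blast
    ultimately have "countable (C \<inter> B)"
      by (meson Int_mono countable_subset order_refl)
    then show False
      using \<open>p \<in> C - D\<close> \<open>B \<in> \<B>\<close> \<open>p \<in> B\<close> by (auto simp: D_def)
  qed
  \<comment> \<open>With the endpoints removed, \<open>{x<..<z}\<close> and \<open>{z<..<y}\<close>
    are open neighbourhoods of the condensation points \<open>p'\<close> and \<open>q'\<close>
    chosen below.\<close>
  define K where "K = C \<inter> {x..y} - (D \<union> {x, y})"
  have "infinite K"
    unfolding K_def using assms \<open>countable D\<close>
    by (metis countable_Un countable_finite finite.emptyI finite_insert uncountable_minus_countable)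
  then obtain p where "p \<in> K"
    by (metis all_not_in_conv finite.emptyI)
  have "infinite (K - {p})"
    using \<open>infinite K\<close> by simp
  then obtain q where "q \<in> K" "q \<noteq> p"
    by (metis Diff_iff all_not_in_conv finite.emptyI insertI1)
  obtain p' q' where pq: "p' \<in> K" "q' \<in> K" "p' < q'"
    using \<open>p \<in> K\<close> \<open>q \<in> K\<close> \<open>q \<noteq> p\<close> by (metis linorder_neqE)
  define z where "z = (p' + q') / 2"
  have *: "p' < z" "z < q'" "x < p'" "q' < y"
    using pq unfolding z_def K_def by auto
  have "uncountable (C \<inter> {x<..<z})" "uncountable (C \<inter> {z<..<y})"
    using pq * by (intro condensation[of p'] condensation[of q']; auto simp: K_def)+
  then have "uncountable (C \<inter> {x..z})" "uncountable (C \<inter> {z..y})"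
    by (meson Int_mono countable_subset order_refl greaterThanLessThan_subseteq_atLeastAtMost_iff)+
  with * show ?thesis
    by (intro that[of z]) auto
qed

text \<open>The set \<open>dyadics\<close> has natural numerators only, hence the assumption
  \<open>0 \<le> a\<close>.\<close>

lemma dyadics_dense:
  fixes a b :: real
  assumes "0 \<le> a" "a < b"
  obtains q where "q \<in> dyadics" "a < q" "q < b"
proof -
  obtain n :: nat where "1 / (b - a) < 2 ^ n"
    using real_arch_pow[of 2] by auto
  then have n: "1 < (b - a) * 2 ^ n"
    using assms by (simp add: field_simps)
  define m where "m = nat (\<lfloor>a * 2 ^ n\<rfloor> + 1)"
  have "real m = \<lfloor>a * 2 ^ n\<rfloor> + 1"
    using assms by (simp add: m_def)
  then have "a * 2 ^ n < m" "m \<le> a * 2 ^ n + 1"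
    by linarith+
  then have "a * 2 ^ n < m" "m < b * 2 ^ n"
    using n by (auto simp: algebra_simps)
  then show ?thesis
    by (intro that[of "m / 2 ^ n"]) (auto simp: dyadics_def field_simps)
qed

text \<open>Repeated splitting places a point \<open>d q\<close> for each dyadic \<open>q\<close> in
  [0, 1] such that \<open>C\<close> is uncountable between any two of these points. \<open>F\<close>
  is the generalized inverse of \<open>d\<close>: jumps of \<open>d\<close> become plateaus of
  \<open>F\<close>, and strict monotonicity of \<open>d\<close> makes \<open>F\<close>
  continuous.\<close>

lemma Cantor_function_exists:
  fixes C :: "real set"
  assumes "uncountable C"
  obtains a b and F :: "real \<Rightarrow> real"
  where "a < b" "F a = 0" "F b = 1" "continuous_on {a..b} F" "mono_on {a..b} F"
    "\<And>u v. \<lbrakk>a \<le> u; u \<le> v; v \<le> b; {u<..<v} \<inter> C = {}\<rbrakk> \<Longrightarrow> F u = F v"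
proof -
  define R where "R x y \<longleftrightarrow> x < y \<and> uncountable (C \<inter> {x..y})" for x y
  have C_eq: "(\<Union>n::nat. C \<inter> {-real n..real n}) = C"
  proof (intro equalityI subsetI)
    fix x assume "x \<in> C"
    moreover obtain n :: nat where "\<bar>x\<bar> \<le> real n"
      using real_arch_simple by blast
    ultimately show "x \<in> (\<Union>n::nat. C \<inter> {-real n..real n})"
      by (auto simp: abs_le_iff minus_le_iff)
  qed auto
  have "\<exists>n::nat. uncountable (C \<inter> {-real n..real n})"
  proof (rule ccontr)
    assume "\<not> ?thesis"
    then have "countable (\<Union>n::nat. C \<inter> {-real n..real n})"
      by (intro countable_UN) auto
    with C_eq assms show False by argo
  qed
  then obtain n :: nat where n: "uncountable (C \<inter> {-real n..real n})"
    by blast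
  \<comment> \<open>The strict inequality in \<open>R\<close> also comes from the splitting
    lemma.\<close>
  then have "R (-real n) (real n)"
    unfolding R_def by (auto elim: uncountable_Int_interval_split)
  then obtain a b where Rab: "R a b" by blast
  \<comment> \<open>The recursion on dyadic fractions asks for a dense and transitive relation;
    density of \<open>R\<close> is the splitting lemma.\<close>
  have "\<exists>d :: real \<Rightarrow> real. d 0 = a \<and> d 1 = b \<and>
    (\<forall>x \<in> dyadics \<inter> {0..1}. \<forall>y \<in> dyadics \<inter> {0..1}. x < y \<longrightarrow> R (d x) (d y))"
  proof (rule recursion_on_dyadic_fractions[of R, OF Rab])
    show "\<exists>z. R x z \<and> R z y" if "R x y" for x y
      using that uncountable_Int_interval_split[of C x y] unfolding R_def by metis
    show "R x z" if "R x y" "R y z" for x y z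
    proof -
      have "C \<inter> {x..y} \<subseteq> C \<inter> {x..z}"
        using that by (auto simp: R_def)
      then show ?thesis
        using that unfolding R_def by (meson countable_subset order.strict_trans)
    qed
  qed
  then obtain d :: "real \<Rightarrow> real" where d: "d 0 = a" "d 1 = b"
    and d_dyadics: "\<forall>x \<in> dyadics \<inter> {0..1}. \<forall>y \<in> dyadics \<inter> {0..1}. x < y \<longrightarrow> R (d x) (d y)"
    by blast
  have dR: "R (d p) (d q)" if "p \<in> dyadics" "q \<in> dyadics" "0 \<le> p" "p < q" "q \<le> 1" for p q
    using d_dyadics that by auto
  have d_less: "d p < d q" if "p \<in> dyadics" "q \<in> dyadics" "0 \<le> p" "p < q" "q \<le> 1" for p q
    using dR[OF that] by (simp add: R_def)
  have dy01: "0 \<in> (dyadics :: real set)" "1 \<in> (dyadics :: real set)"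
    using real_in_dyadics[of 0] real_in_dyadics[of 1] by auto
  define S where "S x = {q \<in> dyadics \<inter> {0..1}. d q \<le> x}" for x
  define F where "F x = Sup (S x)" for x
  have bdd: "bdd_above (S x)" for x
    by (auto simp: S_def bdd_above_def)
  have S0: "0 \<in> S x" if "a \<le> x" for x
    using that dy01 d by (auto simp: S_def)
  have F_ge: "q \<le> F x" if "q \<in> dyadics" "0 \<le> q" "q \<le> 1" "d q \<le> x" for q x
    unfolding F_def using that by (intro cSup_upper bdd) (auto simp: S_def)
  have F_le: "F x \<le> q" if "q \<in> dyadics" "0 \<le> q" "q \<le> 1" "x < d q" "a \<le> x" for q x
    unfolding F_def
  proof (rule cSup_least)
    show "S x \<noteq> {}" using S0 that by blast
    show "p \<le> q" if "p \<in> S x" for p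
      using that d_less[of q p] \<open>q \<in> dyadics\<close> \<open>0 \<le> q\<close> \<open>x < d q\<close> unfolding S_def by force
  qed
  have F01: "0 \<le> F x" "F x \<le> 1" if "a \<le> x" for x
  proof -
    show "0 \<le> F x"
      using F_ge[of 0 x] dy01 d that by auto
    have "S x \<noteq> {}" using S0[OF that] by blast
    then show "F x \<le> 1"
      unfolding F_def by (rule cSup_least) (simp add: S_def)
  qed
  show ?thesis
  proof (rule that)
    show "a < b" using Rab by (simp add: R_def)
    have "S a = {0}"
      using S0[of a] d d_less[of 0] dy01 by (force simp: S_def)
    then show "F a = 0" by (simp add: F_def)
    show "F b = 1"
      using F_ge[of 1 b] F01[of b] d dy01 \<open>a < b\<close> by auto
    show "mono_on {a..b} F"
    proof (rule mono_onI)
      fix u v assume "u \<in> {a..b}" "v \<in> {a..b}" "u \<le> v"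
      then have "0 \<in> S u" "S u \<subseteq> S v"
        using S0[of u] by (simp, auto simp: S_def)
      then show "F u \<le> F v"
        unfolding F_def using bdd by (intro cSup_subset_mono) auto
    qed
    then have mono: "F u \<le> F v" if "a \<le> u" "u \<le> v" "v \<le> b" for u v
      using that by (auto simp: mono_on_def)
    show "continuous_on {a..b} F"
      unfolding continuous_on
    proof
      fix x assume x: "x \<in> {a..b}"
      have ev: "eventually (\<lambda>t. t \<in> {a..b}) (at x within {a..b})"
        by (simp add: eventually_at_filter)
      show "(F \<longlongrightarrow> F x) (at x within {a..b})"
      proof (rule order_tendstoI)
        fix l assume "l < F x"
        show "eventually (\<lambda>t. l < F t) (at x within {a..b})"
        \<comment> \<open>Density of the dyadics is available only above 0; for negative
          \<open>l\<close> the bound \<open>0 \<le> F t\<close> suffices.\<close>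
        proof (cases "l < 0")
          case True
          show ?thesis
            using ev
          proof eventually_elim
            case (elim t)
            then show ?case
              using F01(1)[of t] True by auto
          qed
        next
          case False
          then obtain q where q: "q \<in> dyadics" "l < q" "q < F x"
            using dyadics_dense[of l "F x"] \<open>l < F x\<close> by auto
          \<comment> \<open>\<open>q\<close> alone would give only \<open>d q \<le> x\<close>. The
            second dyadic \<open>r\<close> makes this strict, so that \<open>d q < t\<close>, and
            hence \<open>l < q \<le> F t\<close>, persists for \<open>t\<close> near
            \<open>x\<close>.\<close>
          then obtain r where r: "r \<in> dyadics" "q < r" "r < F x"
            using dyadics_dense[of q "F x"] False by auto
          have "d q < d r" 
            using q r False F01(2)[of x] x by (intro d_less) auto
          also have "d r \<le> x"
            using F_le[of r x] q r False F01(2)[of x] x by fastforce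
          finally have "eventually (\<lambda>t. d q < t) (at x within {a..b})"
            using order_tendstoD(1)[OF tendsto_ident_at] by blast
          with ev show ?thesis
          proof eventually_elim
            case (elim t)
            then show ?case
              using F_ge[of q t] q False F01(2)[of x] x by auto
          qed
        qed
      next
        fix u assume "F x < u"
        show "eventually (\<lambda>t. F t < u) (at x within {a..b})"
        proof (cases "u > 1")
          case True
          show ?thesis
            using ev
          proof eventually_elim
            case (elim t)
            then show ?case
              using F01(2)[of t] True by auto
          qed
        next
          case False
          obtain q where q: "q \<in> dyadics" "F x < q" "q < u"
            using dyadics_dense[of "F x" u] \<open>F x < u\<close> F01(1)[of x] x by auto
          have "x < d q"
            using F_ge[of q x] q False F01(1)[of x] x by fastforce
          then have "eventually (\<lambda>t. t < d q) (at x within {a..b})"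
            using order_tendstoD(2)[OF tendsto_ident_at] by blast
          with ev show ?thesis
          proof eventually_elim
            case (elim t)
            then show ?case
              using F_le[of q t] q False F01(1)[of x] x by auto
          qed
        qed
      qed
    qed
    show "F u = F v" if uv: "a \<le> u" "u \<le> v" "v \<le> b" and gap: "{u<..<v} \<inter> C = {}" for u v
    proof (rule ccontr)
      assume "F u \<noteq> F v"
      then have "F u < F v" using mono[OF uv] by simp
      moreover have "0 \<le> F u" "F v \<le> 1" using F01 uv by auto
      ultimately obtain p where p: "p \<in> dyadics" "F u < p" "p < F v"
        using dyadics_dense by blast
      then obtain q where q: "q \<in> dyadics" "p < q" "q < F v"
        using dyadics_dense[of p "F v"] \<open>0 \<le> F u\<close> by auto
      \<comment> \<open>\<open>r\<close> serves to push \<open>d q\<close> strictly below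
        \<open>v\<close>, so that the interval from \<open>d p\<close> to \<open>d q\<close>, rich
        in points of \<open>C\<close>, lies inside the gap.\<close>
      obtain r where r: "r \<in> dyadics" "q < r" "r < F v"
        using dyadics_dense[of q "F v"] p q \<open>0 \<le> F u\<close> by auto
      note bounds = p q r \<open>0 \<le> F u\<close> \<open>F v \<le> 1\<close>
      have "u < d p"
        using F_ge[of p u] bounds by force
      moreover have "d q < d r"
        using bounds by (intro d_less) auto
      moreover have "d r \<le> v"
        using F_le[of r v] bounds uv by force
      ultimately have "C \<inter> {d p..d q} \<subseteq> {u<..<v} \<inter> C"
        by auto
      moreover have "uncountable (C \<inter> {d p..d q})"
        using dR[of p q] bounds by (auto simp: R_def)
      ultimately show False
        using gap by auto
    qed
  qed
qed

section \<open>A continuous function of unbounded variation\<close>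

text \<open>At the points 1/k the values alternate in sign and have size 1/k, so the variation on
  [0, 1] dominates the harmonic series. At \<open>t = 0\<close> the factor \<open>t\<close> gives
  the value 0, which is the limit there.\<close>

definition oscillation :: "real \<Rightarrow> real" where
  "oscillation t = t * cos (pi / t)"

lemma oscillation_inverse: "oscillation (1 / real k) = (-1) ^ k / real k"
  by (simp add: oscillation_def mult.commute)

lemma continuous_on_oscillation: "continuous_on A oscillation"
proof -
  have "isCont oscillation t" for t
  proof (cases "t = 0")
    case True
    have "((\<lambda>t. \<bar>t\<bar>) \<longlongrightarrow> 0) (at (0 :: real))"
      by (auto intro!: tendsto_eq_intros)
    moreover have "\<forall>\<^sub>F t in at 0. norm (oscillation t) \<le> \<bar>t\<bar>"
      by (auto simp: oscillation_def abs_mult mult_left_le intro: always_eventually)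
    ultimately have "(oscillation \<longlongrightarrow> 0) (at 0)"
      by (rule Lim_null_comparison[rotated])
    then show ?thesis
      using True by (simp add: isCont_def oscillation_def)
  next
    case False
    then show ?thesis
      unfolding oscillation_def by (intro continuous_intros)
  qed
  then show ?thesis
    by (simp add: continuous_at_imp_continuous_on)
qed

text \<open>At points \<open>x k\<close> with \<open>F (x k) = 1 / real (Suc k)\<close>, which
  decrease as \<open>F\<close> is monotone, the composition alternates in sign. A Lipschitz constant
  \<open>L\<close> would bound the partial sums of the harmonic series by
  \<open>L * (b - a)\<close>.\<close>

lemma oscillation_comp_not_lipschitz:
  fixes F :: "real \<Rightarrow> real"
  assumes "a \<le> b" and "F a = 0" and "F b = 1"
    and cont: "continuous_on {a..b} F" and mono: "mono_on {a..b} F"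
  shows "\<not> L-lipschitz_on {a..b} (oscillation \<circ> F)"
proof
  assume L: "L-lipschitz_on {a..b} (oscillation \<circ> F)"
  then have "0 \<le> L" by (rule lipschitz_on_nonneg)
  have "\<exists>x. a \<le> x \<and> x \<le> b \<and> F x = 1 / real (Suc k)" for k
    using assms by (intro IVT') auto
  then obtain x where x: "\<And>k. a \<le> x k" "\<And>k. x k \<le> b" "\<And>k. F (x k) = 1 / real (Suc k)"
    by metis
  have decr: "x (Suc k) \<le> x k" for k
  proof (rule ccontr)
    assume "\<not> ?thesis"
    then have "F (x k) \<le> F (x (Suc k))"
      using x by (intro mono_onD[OF mono]) auto
    then show False
      unfolding x by (simp add: field_simps)
  qed
  have step: "inverse (real (Suc k)) \<le> L * (x k - x (Suc k))" for k
  proof -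
    have "inverse (real (Suc k)) \<le> \<bar>oscillation (F (x k)) - oscillation (F (x (Suc k)))\<bar>"
    proof -
      \<comment> \<open>Opposite signs turn the difference into a sum of absolute values, of which
        the first summand is kept.\<close>
      have "oscillation (F (x k)) - oscillation (F (x (Suc k)))
          = (-1) ^ Suc k * (1 / real (Suc k) + 1 / real (Suc (Suc k)))"
        unfolding x oscillation_inverse by (simp add: algebra_simps)
      then show ?thesis
        by (simp add: abs_mult power_abs inverse_eq_divide del: power_Suc)
    qed
    also have "\<dots> \<le> L * \<bar>x k - x (Suc k)\<bar>"
      using lipschitz_onD[OF L, of "x k" "x (Suc k)"] x by (auto simp: dist_real_def)
    finally show ?thesis
      using decr[of k] by simp
  qed
  have "summable (\<lambda>k. inverse (real (Suc k)))"
  proof (rule bounded_imp_summable)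
    fix n
    have "(\<Sum>k\<le>n. inverse (real (Suc k))) \<le> (\<Sum>k\<le>n. L * (x k - x (Suc k)))"
      by (intro sum_mono step)
    also have "\<dots> = L * (x 0 - x (Suc n))"
      by (simp add: sum_distrib_left[symmetric] sum_telescope)
    also have "\<dots> \<le> L * (b - a)"
      using x(1)[of "Suc n"] x(2)[of 0] \<open>0 \<le> L\<close> by (intro mult_left_mono) auto
    finally show "(\<Sum>k\<le>n. inverse (real (Suc k))) \<le> L * (b - a)" .
  qed simp
  then have "summable (\<lambda>k. inverse (real k))"
    by (subst (asm) summable_Suc_iff)
  then show False
    using not_summable_harmonic by blast
qed

section \<open>The intrinsic metric on subsets of the line\<close>

lemma curve_length_nonneg:
  assumes "a \<le> b"
  shows "0 \<le> curve_length a b \<gamma>"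
proof -
  \<comment> \<open>The supremum of the empty set in \<open>ereal\<close> is minus infinity, so a
    subdivision has to be exhibited; for \<open>a = b\<close> it must have
    \<open>n = 0\<close>.\<close>
  have "\<exists>n t. is_subdivision a b n t"
  proof (cases "a = b")
    case True
    then have "is_subdivision a b 0 (\<lambda>_. a)"
      by (simp add: is_subdivision_def)
    then show ?thesis by blast
  next
    case False
    with assms have "is_subdivision a b 1 (\<lambda>k. if k = 0 then a else b)"
      by (simp add: is_subdivision_def)
    then show ?thesis by blast
  qed
  then obtain n t where "is_subdivision a b n t" by blast
  then have "ereal (\<Sum>k=1..n. dist (\<gamma> (t k)) (\<gamma> (t (k - 1)))) \<le> curve_length a b \<gamma>"
    unfolding curve_length_def by (intro Sup_upper) blast
  then show ?thesis
    by (rule order_trans[rotated]) (simp add: sum_nonneg)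
qed

lemma intrinsic_metric_nonneg: "0 \<le> intrinsic_metric E x y"
  unfolding intrinsic_metric_def using curve_length_nonneg by (intro Inf_greatest) auto

lemma intrinsic_metric_le_segment:
  fixes u v :: real
  assumes "u \<le> v" "{u..v} \<subseteq> E"
  shows "intrinsic_metric E u v \<le> ereal (v - u)"
proof -
  \<comment> \<open>For the identity path every subdivision sum telescopes to
    \<open>v - u\<close>.\<close>
  have "curve_length u v (\<lambda>t. t) \<le> ereal (v - u)"
    unfolding curve_length_def
  proof (rule Sup_least, clarsimp)
    fix n and t :: "nat \<Rightarrow> real" assume t: "is_subdivision u v n t"
    have "(\<Sum>k=1..n. dist (t k) (t (k - Suc 0))) = (\<Sum>k=1..n. t k - t (k - 1))"
    proof (rule sum.cong)
      fix k assume "k \<in> {1..n}"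
      then have "k - 1 < n" "Suc (k - 1) = k"
        by auto
      then have "t (k - 1) < t k"
        using t unfolding is_subdivision_def by metis
      then show "dist (t k) (t (k - Suc 0)) = t k - t (k - 1)"
        by (simp add: dist_real_def)
    qed simp
    also have "\<dots> = t n - t 0"
      by (induction n) auto
    finally show "(\<Sum>k=Suc 0..n. dist (t k) (t (k - Suc 0))) \<le> v - u"
      using t by (simp add: is_subdivision_def)
  qed
  moreover from this have "curve_length u v (\<lambda>t. t) < \<infinity>"
    by (rule order.strict_trans1) simp
  then have "intrinsic_metric E u v \<le> curve_length u v (\<lambda>t. t)"
    unfolding intrinsic_metric_def using assms
    by (intro Inf_lower CollectI exI[of _ u] exI[of _ v] exI[of _ "\<lambda>t. t"] conjI refl)
       (auto intro: continuous_on_id)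
  ultimately show ?thesis by order
qed

text \<open>Finite distance provides a path in \<open>E\<close>; its image is connected, hence
  convex on the line, and contains both endpoints.\<close>

lemma intrinsic_metric_finite_imp_segment:
  fixes x y :: real
  assumes "intrinsic_metric E x y < \<infinity>"
  shows "closed_segment x y \<subseteq> E"
proof -
  from assms obtain c a b \<gamma> where "c = curve_length a b \<gamma> \<and> a \<le> b \<and> continuous_on {a..b} \<gamma> \<and>
      \<gamma> ` {a..b} \<subseteq> E \<and> \<gamma> a = x \<and> \<gamma> b = y \<and> curve_length a b \<gamma> < \<infinity>"
    unfolding intrinsic_metric_def Inf_less_iff by (elim bexE CollectE exE) (rule that)
  then have "a \<le> b" "continuous_on {a..b} \<gamma>" "\<gamma> ` {a..b} \<subseteq> E" "\<gamma> a = x" "\<gamma> b = y"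
    by simp_all
  moreover from this have "convex (\<gamma> ` {a..b})"
    by (metis connected_continuous_image connected_Icc connected_convex_1)
  moreover from calculation have "x \<in> \<gamma> ` {a..b}" "y \<in> \<gamma> ` {a..b}"
    by auto
  ultimately show ?thesis
    by (meson closed_segment_subset order_trans)
qed

lemma intrinsically_lipschitz_on_segmentE:
  fixes f :: "real \<Rightarrow> real"
  assumes "intrinsically_lipschitz_on E f"
  obtains L where "0 \<le> L" "\<And>u v. \<lbrakk>u \<le> v; {u..v} \<subseteq> E\<rbrakk> \<Longrightarrow> \<bar>f u - f v\<bar> \<le> L * (v - u)"
proof -
  obtain L where L: "\<And>u v. \<lbrakk>u \<in> E; v \<in> E; intrinsic_metric E u v < \<infinity>\<rbrakk> \<Longrightarrow>
      ereal \<bar>f u - f v\<bar> \<le> ereal L * intrinsic_metric E u v"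
    using assms unfolding intrinsically_lipschitz_on_def by blast
  show ?thesis
  \<comment> \<open>The definition admits negative constants, for instance if \<open>E\<close>
    contains no nondegenerate segment. A nonnegative one is needed to multiply the bound on the
    metric.\<close>
  proof (rule that[of "max 0 L"])
    fix u v assume uv: "u \<le> v" "{u..v} \<subseteq> E"
    note le = intrinsic_metric_le_segment[OF uv]
    then have "intrinsic_metric E u v < \<infinity>"
      by (rule order.strict_trans1) simp
    then have "ereal \<bar>f u - f v\<bar> \<le> ereal L * intrinsic_metric E u v"
      using uv by (intro L) auto
    also have "\<dots> \<le> ereal (max 0 L) * intrinsic_metric E u v"
      by (intro ereal_mult_right_mono intrinsic_metric_nonneg) simp
    also have "\<dots> \<le> ereal (max 0 L) * ereal (v - u)"
      using le by (intro ereal_mult_left_mono) (simp_all add: max_def)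
    finally show "\<bar>f u - f v\<bar> \<le> max 0 L * (v - u)"
      by (metis ereal_less_eq(3) times_ereal.simps(1))
  qed simp
qed

section \<open>Countable closure forces Lipschitz continuity\<close>

lemma antimono_off_countable:
  fixes g :: "real \<Rightarrow> real"
  assumes "x \<le> y" and cont: "continuous_on {x..y} g" and "countable C"
    and right: "\<And>s. \<lbrakk>x \<le> s; s < y; s \<notin> C\<rbrakk> \<Longrightarrow> \<exists>t. s < t \<and> t \<le> y \<and> g t \<le> g s"
  shows "g y \<le> g x"
proof (rule ccontr)
  assume "\<not> ?thesis"
  then have "uncountable {g x<..<g y}"
    by (simp add: uncountable_open_interval)
  \<comment> \<open>A level outside the image of \<open>C\<close> ensures that wherever
    \<open>g\<close> equals \<open>c\<close>, the hypothesis \<open>right\<close> is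
    applicable.\<close>
  then obtain c where c: "c \<in> {g x<..<g y}" "c \<notin> g ` C"
    using \<open>countable C\<close> countable_subset[OF subsetI countable_image[of C g]] by blast
  define T where "T = {x..y} \<inter> g -` {..c}"
  have "closed T"
    unfolding T_def by (intro continuous_closed_preimage cont closed_atLeastAtMost closed_atMost)
  then have "compact T"
    by (simp add: compact_eq_bounded_closed T_def bounded_Int)
  moreover have "x \<in> T"
    using c \<open>x \<le> y\<close> by (auto simp: T_def)
  ultimately obtain s where s: "s \<in> T" "\<And>t. t \<in> T \<Longrightarrow> t \<le> s"
    using compact_attains_sup[of T] by auto
  have "s < y"
    using s(1) c by (cases "s = y") (auto simp: T_def)
  \<comment> \<open>The intermediate value theorem on \<open>{s..y}\<close> yields a point of
    \<open>T\<close> at level \<open>c\<close>; as \<open>s\<close> is the last point of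
    \<open>T\<close>, it is \<open>s\<close> itself.\<close>
  have "g s = c"
  proof -
    obtain t where "s \<le> t" "t \<le> y" "g t = c"
      using IVT'[of g s c y] s(1) c \<open>s < y\<close> continuous_on_subset[OF cont, of "{s..y}"]
      by (auto simp: T_def)
    moreover from this have "t \<le> s"
      using s(1) by (intro s(2)) (auto simp: T_def)
    ultimately show ?thesis by simp
  qed
  then have "s \<notin> C" using c by auto
  then obtain t where "s < t" "t \<le> y" "g t \<le> g s"
    using right[of s] s(1) \<open>s < y\<close> by (auto simp: T_def)
  then have "t \<in> T"
    using s(1) \<open>g s = c\<close> by (auto simp: T_def)
  then show False
    using s(2) \<open>s < t\<close> by force
qed

lemma lipschitz_off_countable_closure:
  fixes f :: "real \<Rightarrow> real"
  assumes count: "countable (closure \<Theta>)" and I: "is_interval I" and cont: "continuous_on I f"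
    and intr: "intrinsically_lipschitz_on (I - \<Theta>) f"
  shows "\<exists>L. L-lipschitz_on I f"
proof -
  obtain L where "0 \<le> L"
    and L: "\<And>u v. \<lbrakk>u \<le> v; {u..v} \<subseteq> I - \<Theta>\<rbrakk> \<Longrightarrow> \<bar>f u - f v\<bar> \<le> L * (v - u)"
    by (rule intrinsically_lipschitz_on_segmentE[OF intr]) (rule that)
  \<comment> \<open>The two signs \<open>\<sigma>\<close> give the upper and the lower bound for
    \<open>f y - f x\<close>.\<close>
  have one_sided: "\<sigma> * (f y - f x) \<le> L * (y - x)"
    if xy: "x \<in> I" "y \<in> I" "x \<le> y" and \<sigma>: "\<sigma> \<in> {1, -1}" for x y \<sigma>
  proof -
    have "{x..y} \<subseteq> I"
      using I xy by (meson atLeastAtMost_iff mem_is_interval_1_I subsetI)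
    define g where "g t = \<sigma> * f t - L * t" for t
    have "g y \<le> g x"
    proof (rule antimono_off_countable[OF \<open>x \<le> y\<close> _ count])
      show "continuous_on {x..y} g"
        unfolding g_def using continuous_on_subset[OF cont \<open>{x..y} \<subseteq> I\<close>]
        by (intro continuous_intros)
      fix s assume s: "x \<le> s" "s < y" "s \<notin> closure \<Theta>"
      then obtain e where e: "e > 0" "ball s e \<subseteq> - closure \<Theta>"
        using open_contains_ball[of "- closure \<Theta>"] by auto
      \<comment> \<open>Half the radius keeps \<open>{s..t}\<close> inside the open ball and so off
        \<open>\<Theta>\<close>; the minimum with \<open>y\<close> keeps it inside
        \<open>I\<close>.\<close>
      define t where "t = min y (s + e / 2)"
      have t: "s < t" "t \<le> y" "t \<le> s + e / 2"
        using s e by (auto simp: t_def)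
      then have "{s..t} \<subseteq> ball s e"
        using e by (auto simp: dist_real_def)
      then have "{s..t} \<subseteq> I - \<Theta>"
        using e \<open>{x..y} \<subseteq> I\<close> s t closure_subset by fastforce
      then have "\<bar>f s - f t\<bar> \<le> L * (t - s)"
        using t by (intro L) auto
      then have "g t \<le> g s"
        using \<sigma> by (auto simp: g_def algebra_simps)
      with t show "\<exists>t. s < t \<and> t \<le> y \<and> g t \<le> g s" by blast
    qed
    then show ?thesis
      by (simp add: g_def algebra_simps)
  qed
  have "L-lipschitz_on I f"
  proof (rule lipschitz_on_leI)
    fix x y assume "x \<in> I" "y \<in> I" "x \<le> y"
    then show "dist (f x) (f y) \<le> L * dist x y"
      using one_sided[of x y 1] one_sided[of x y "-1"] by (auto simp: dist_real_def)
  qed fact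
  then show ?thesis by blast
qed

section \<open>A counterexample for uncountable closure\<close>

text \<open>A segment avoiding \<open>\<Theta>\<close> lies on a plateau of \<open>F\<close>, so
  \<open>oscillation \<circ> F\<close> agrees at any two points of finite intrinsic distance and the
  constant 0 works.\<close>

lemma intrinsically_lipschitz_nonlipschitz_exists:
  assumes "uncountable (closure \<Theta>)"
  obtains I and f :: "real \<Rightarrow> real" where "is_interval I" "continuous_on I f"
    "intrinsically_lipschitz_on (I - \<Theta>) f" "\<And>L. \<not> L-lipschitz_on I f"
proof -
  obtain a b and F :: "real \<Rightarrow> real" where F: "a < b" "F a = 0" "F b = 1"
      "continuous_on {a..b} F" "mono_on {a..b} F"
    and gap: "\<And>u v. \<lbrakk>a \<le> u; u \<le> v; v \<le> b; {u<..<v} \<inter> closure \<Theta> = {}\<rbrakk> \<Longrightarrow> F u = F v"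
    by (rule Cantor_function_exists[OF assms]) (rule that)
  have F_eq: "F x = F y"
    if xy: "x \<in> {a..b} - \<Theta>" "y \<in> {a..b} - \<Theta>"
      and seg: "closed_segment x y \<subseteq> {a..b} - \<Theta>" for x y
  proof -
    have "{min x y<..<max x y} \<inter> \<Theta> = {}"
      using seg by (force simp: closed_segment_eq_real_ivl subset_iff min_def max_def split: if_splits)
    \<comment> \<open>An open set disjoint from \<open>\<Theta>\<close> is disjoint from its
      closure, which is the set to which \<open>F\<close> is adapted.\<close>
    then have "{min x y<..<max x y} \<inter> closure \<Theta> = {}"
      by (simp add: open_Int_closure_eq_empty)
    then have "F (min x y) = F (max x y)"
      using xy by (intro gap) auto
    then show ?thesis
      by (simp add: min_def max_def split: if_splits)
  qed
  show ?thesis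
  proof (rule that[of "{a..b}" "oscillation \<circ> F"])
    show "is_interval {a..b}" by (rule is_interval_cc)
    show "continuous_on {a..b} (oscillation \<circ> F)"
      using F by (intro continuous_on_compose continuous_on_oscillation)
    show "intrinsically_lipschitz_on ({a..b} - \<Theta>) (oscillation \<circ> F)"
      unfolding intrinsically_lipschitz_on_def
    proof (intro exI[of _ 0] ballI impI)
      fix x y assume "x \<in> {a..b} - \<Theta>" "y \<in> {a..b} - \<Theta>"
        and "intrinsic_metric ({a..b} - \<Theta>) x y < \<infinity>"
      then have "F x = F y"
        by (intro F_eq intrinsic_metric_finite_imp_segment)
      then show "ereal \<bar>(oscillation \<circ> F) x - (oscillation \<circ> F) y\<bar>
          \<le> ereal 0 * intrinsic_metric ({a..b} - \<Theta>) x y"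
        by (simp flip: zero_ereal_def)
    qed
    show "\<not> L-lipschitz_on {a..b} (oscillation \<circ> F)" for L
      using F by (intro oscillation_comp_not_lipschitz) auto
  qed
qed

theorem theorem23:
  fixes \<Theta> :: "real set"
  shows "countable (closure \<Theta>) \<longleftrightarrow>
    (\<forall>(I :: real set) (f :: real \<Rightarrow> real).
       is_interval I \<longrightarrow> continuous_on I f \<longrightarrow> intrinsically_lipschitz_on (I - \<Theta>) f \<longrightarrow>
       (\<exists>L. L-lipschitz_on I f))"
  using lipschitz_off_countable_closure intrinsically_lipschitz_nonlipschitz_exists by metis

end
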